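(* Let $v$ be a vertex of a looped simple graph $G$. Then $M(IAS(G-v))=(M(IAS(G))/v_\phi)-v_\chi-v_\psi$, where the ground set of $M(IAS(G-v))$ is identified with $W(G)\setminus\{v_\phi,v_\chi,v_\psi\}$ in the natural way.
   Context: A looped simple graph is a finite graph in which each vertex may carry at most one loop and distinct non-loop edges join distinct pairs of vertices; $G-v$ is obtained by deleting $v$ and its incident edges. $A(G)$ is the adjacency matrix over $GF(2)$ (diagonal $1$ iff looped). $M(IAS(G))$ is the binary matroid represented by the columns of $(I\mid A(G)\mid I+A(G))$; its ground set $W(G)$ consists of columns $w_\phi,w_\chi,w_\psi$ for $w\in V(G)$, the columns of $w$ in $I$, $A(G)$, $I+A(G)$. $/$ denotes contraction and $-$ deletion. *)

theory Defs
  imports Complex_Main "HOL-Library.Z2" "HOL-Library.Function_Algebras"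
begin

section \<open>Looped simple graphs\<close>

text \<open>An edge is its set of endpoints: a singleton is a loop, a two-element set a non-loop edge.
  Hence there is at most one loop per vertex and at most one edge per pair of vertices.\<close>

record 'a looped_graph =
  verts :: "'a set"
  edges :: "'a set set"

locale looped_simple_graph =
  fixes G :: "'a looped_graph"
  assumes finite_verts: "finite (verts G)"
    and edge_subset: "e \<in> edges G \<Longrightarrow> e \<subseteq> verts G"
    and edge_card: "e \<in> edges G \<Longrightarrow> card e \<in> {1, 2}"

definition delete_vertex :: "'a looped_graph \<Rightarrow> 'a \<Rightarrow> 'a looped_graph" where
  "delete_vertex G v = \<lparr>verts = verts G - {v}, edges = {e \<in> edges G. v \<notin> e}\<rparr>"

lemma looped_simple_graph_delete_vertex:
  assumes "looped_simple_graph G"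
  shows "looped_simple_graph (delete_vertex G v)"
proof -
  interpret looped_simple_graph G by fact
  show ?thesis
    by unfold_locales
      (use finite_verts edge_subset edge_card in \<open>auto simp: delete_vertex_def\<close>)
qed

section \<open>Matroids\<close>

record 'e matroid =
  ground :: "'e set"
  indeps :: "'e set set"

locale matroid =
  fixes M :: "'e matroid"
  assumes finite_ground: "finite (ground M)"
    and indeps_subset: "X \<in> indeps M \<Longrightarrow> X \<subseteq> ground M"
    and empty_indep: "{} \<in> indeps M"
    and indep_subset: "X \<in> indeps M \<Longrightarrow> Y \<subseteq> X \<Longrightarrow> Y \<in> indeps M"
    and augmentation: "X \<in> indeps M \<Longrightarrow> Y \<in> indeps M \<Longrightarrow> card X < card Y \<Longrightarrow>
      \<exists>y \<in> Y - X. insert y X \<in> indeps M"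

definition basis_of :: "'e matroid \<Rightarrow> 'e set \<Rightarrow> 'e set \<Rightarrow> bool" where
  "basis_of M T B \<longleftrightarrow> B \<subseteq> T \<and> B \<in> indeps M \<and>
     (\<forall>B'. B \<subseteq> B' \<longrightarrow> B' \<subseteq> T \<longrightarrow> B' \<in> indeps M \<longrightarrow> B' = B)"

definition delete :: "'e matroid \<Rightarrow> 'e set \<Rightarrow> 'e matroid" where
  "delete M T = \<lparr>ground = ground M - T, indeps = {X \<in> indeps M. X \<inter> T = {}}\<rparr>"

text \<open>In a matroid the choice of the basis \<open>B\<close> of \<open>T\<close> is irrelevant. If \<open>T\<close> consists of a single
  loop, then \<open>B\<close> is empty and contraction agrees with deletion.\<close>

definition contract :: "'e matroid \<Rightarrow> 'e set \<Rightarrow> 'e matroid" where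
  "contract M T = \<lparr>ground = ground M - T,
     indeps = {X. X \<subseteq> ground M - T \<and> (\<exists>B. basis_of M T B \<and> X \<union> B \<in> indeps M)}\<rparr>"

section \<open>Matroids represented by matrices\<close>

global_interpretation fun_space: vector_space
  "\<lambda>(c :: 'f :: field) (f :: 'r \<Rightarrow> 'f) r. c * f r"
  by unfold_locales (auto simp: fun_eq_iff algebra_simps)

text \<open>A matrix with row set \<open>R\<close> is a function of a row and a column label; a column is extended by
  zero outside \<open>R\<close>.\<close>

definition column :: "'r set \<Rightarrow> ('r \<Rightarrow> 'e \<Rightarrow> 'f :: field) \<Rightarrow> 'e \<Rightarrow> 'r \<Rightarrow> 'f" where
  "column R A e = (\<lambda>r. if r \<in> R then A r e else 0)"

text \<open>Differently labelled columns may be equal as vectors, and are then dependent; this is why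
  injectivity is required.\<close>

definition column_matroid :: "'r set \<Rightarrow> 'e set \<Rightarrow> ('r \<Rightarrow> 'e \<Rightarrow> 'f :: field) \<Rightarrow> 'e matroid" where
  "column_matroid R E A = \<lparr>ground = E,
     indeps = {X. X \<subseteq> E \<and> inj_on (column R A) X \<and> fun_space.independent (column R A ` X)}\<rparr>"

lemma matroid_column_matroid:
  assumes "finite E"
  shows "matroid (column_matroid R E A)"
proof
  fix X Y
  assume X: "X \<in> indeps (column_matroid R E A)" and Y: "Y \<in> indeps (column_matroid R E A)"
    and less: "card X < card Y"
  let ?c = "column R A"
  have fin: "finite X" "finite Y"
    using X Y assms by (auto simp: column_matroid_def intro: finite_subset)
  have card: "card (?c ` X) = card X" "card (?c ` Y) = card Y"
    using X Y by (auto simp: column_matroid_def card_image)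
  have "\<not> ?c ` Y \<subseteq> fun_space.span (?c ` X)"
    using fun_space.independent_span_bound[of "?c ` X" "?c ` Y"] Y fin card less
    by (auto simp: column_matroid_def)
  then obtain y where y: "y \<in> Y" "?c y \<notin> fun_space.span (?c ` X)"
    by auto
  then have new: "?c y \<notin> ?c ` X"
    using fun_space.span_superset by blast
  have "insert y X \<in> indeps (column_matroid R E A)"
    using X Y y new by (auto simp: column_matroid_def fun_space.independent_insert)
  then show "\<exists>y \<in> Y - X. insert y X \<in> indeps (column_matroid R E A)"
    using y new by blast
qed (use assms in \<open>auto simp: column_matroid_def fun_space.independent_empty
      intro: inj_on_subset dest: fun_space.independent_mono[OF _ image_mono]\<close>)

section \<open>The isotropic matroid of a looped simple graph\<close>

datatype 'a ias_elem = Phi 'a | Chi 'a | Psi 'a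

definition ias_ground :: "'a looped_graph \<Rightarrow> 'a ias_elem set" where
  "ias_ground G = Phi ` verts G \<union> Chi ` verts G \<union> Psi ` verts G"

definition identity_matrix :: "'a \<Rightarrow> 'a \<Rightarrow> bit" where
  "identity_matrix u w = of_bool (u = w)"

text \<open>On the diagonal \<open>{u, w}\<close> is a singleton, so that the entry records a loop.\<close>

definition adjacency_matrix :: "'a looped_graph \<Rightarrow> 'a \<Rightarrow> 'a \<Rightarrow> bit" where
  "adjacency_matrix G u w = of_bool ({u, w} \<in> edges G)"

fun ias_matrix :: "'a looped_graph \<Rightarrow> 'a \<Rightarrow> 'a ias_elem \<Rightarrow> bit" where
  "ias_matrix G u (Phi w) = identity_matrix u w"
| "ias_matrix G u (Chi w) = adjacency_matrix G u w"
| "ias_matrix G u (Psi w) = identity_matrix u w + adjacency_matrix G u w"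

definition ias_matroid :: "'a looped_graph \<Rightarrow> 'a ias_elem matroid" where
  "ias_matroid G = column_matroid (verts G) (ias_ground G) (ias_matrix G)"

end

(* Linear independence of a set of columns means that the only coefficients whose weighted row sums
   all vanish are zero. Since the column of Phi v is the unit vector at row v, the row equations of a
   relation on insert (Phi v) X say that its restriction to X satisfies the equations of all rows
   other than v, while row v just determines the coefficient of Phi v. So contracting Phi v amounts
   to deleting row v and the column Phi v from the matrix, and deleting row v together with the
   three columns of v leaves the matrix of G - v. *)

theory Submission
  imports Defs
begin

lemma sum_fun_apply: "(\<Sum>x\<in>X. f x) r = (\<Sum>x\<in>X. f x r)"
  for f :: "'e \<Rightarrow> 'r \<Rightarrow> 'f :: comm_monoid_add"
  by (induction X rule: infinite_finite_induct) auto

text \<open>Coefficients are attached to labels rather than to vectors, so two labels with the same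
  column already give a nontrivial relation. This merges injectivity and independence into one
  condition.\<close>

lemma inj_on_independent_iff:
  fixes c :: "'e \<Rightarrow> 'r \<Rightarrow> 'f :: field"
  assumes "finite X"
  shows "inj_on c X \<and> fun_space.independent (c ` X) \<longleftrightarrow>
    (\<forall>a. (\<forall>r. (\<Sum>x\<in>X. a x * c x r) = 0) \<longrightarrow> (\<forall>x\<in>X. a x = 0))"
    (is "?L \<longleftrightarrow> ?R")
proof
  assume L: ?L
  show ?R
  proof (intro allI impI ballI)
    fix a x
    assume a: "\<forall>r. (\<Sum>x\<in>X. a x * c x r) = 0" and x: "x \<in> X"
    \<comment> \<open>Moves the coefficients from labels to vectors; injectivity of \<open>c\<close>
      on \<open>X\<close> gives \<open>u (c x) = a x\<close>.\<close>
    define u where "u = a \<circ> inv_into X c"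
    have "(\<Sum>w\<in>c ` X. (\<lambda>r. u w * w r)) = 0"
      using a L by (simp add: fun_eq_iff sum_fun_apply sum.reindex u_def)
    with L x assms have "u (c x) = 0"
      by (auto simp: fun_space.dependent_finite)
    with L x show "a x = 0"
      by (simp add: u_def)
  qed
next
  assume R: ?R
  have inj: "inj_on c X"
  proof (rule inj_onI, rule ccontr)
    fix x y
    assume xy: "x \<in> X" "y \<in> X" "c x = c y" "x \<noteq> y"
    \<comment> \<open>As \<open>c x = c y\<close>, the difference of the two indicators is a
      relation on \<open>X\<close>. Its value at \<open>x\<close> is 1 in every
      characteristic.\<close>
    define a :: "'e \<Rightarrow> 'f" where "a = (\<lambda>z. of_bool (z = x) - of_bool (z = y))"
    have "(\<Sum>z\<in>X. a z * c z r) = 0" for r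
    proof -
      have "(\<Sum>z\<in>X. a z * c z r) =
          (\<Sum>z\<in>X. (if z = x then c z r else 0) - (if z = y then c z r else 0))"
        by (intro sum.cong) (auto simp: a_def)
      with xy assms show ?thesis
        by (simp add: sum_subtractf)
    qed
    with R xy have "a x = 0" by blast
    with xy show False by (simp add: a_def)
  qed
  moreover have "fun_space.independent (c ` X)"
  proof
    assume "fun_space.dependent (c ` X)"
    then obtain u x where u: "x \<in> X" "u (c x) \<noteq> 0" "(\<Sum>w\<in>c ` X. (\<lambda>r. u w * w r)) = 0"
      using assms by (auto simp: fun_space.dependent_finite)
    then have "(\<Sum>x\<in>X. u (c x) * c x r) = 0" for r
      using inj by (simp add: fun_eq_iff sum_fun_apply sum.reindex)
    with R u show False
      using spec[OF R, of "u \<circ> c"] by auto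
  qed
  ultimately show ?L ..
qed

text \<open>Columns are extended by zero outside \<open>R\<close>, so rows there impose no condition
  and the row equations over \<open>R\<close> suffice.\<close>

lemma indeps_column_matroid_iff:
  assumes "finite E"
  shows "X \<in> indeps (column_matroid R E A) \<longleftrightarrow> X \<subseteq> E \<and>
    (\<forall>a. (\<forall>r\<in>R. (\<Sum>x\<in>X. a x * A r x) = 0) \<longrightarrow> (\<forall>x\<in>X. a x = 0))"
proof (cases "X \<subseteq> E")
  case True
  have "(\<forall>r. (\<Sum>x\<in>X. a x * column R A x r) = 0) \<longleftrightarrow> (\<forall>r\<in>R. (\<Sum>x\<in>X. a x * A r x) = 0)" for a
  proof -
    have "(\<Sum>x\<in>X. a x * column R A x r) = (if r \<in> R then \<Sum>x\<in>X. a x * A r x else 0)" for r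
      by (simp add: column_def)
    then show ?thesis by auto
  qed
  with True show ?thesis
    using inj_on_independent_iff[OF finite_subset[OF True assms], of "column R A"]
    by (simp add: column_matroid_def)
qed (simp add: column_matroid_def)

lemma delete_column_matroid:
  "delete (column_matroid R E A) T = column_matroid R (E - T) A"
  by (auto simp: delete_def column_matroid_def)

text \<open>Lets the matrix of a graph be exchanged for that of its vertex-deleted subgraph, as the
  two may differ in row \<open>v\<close> and in the columns of \<open>v\<close>.\<close>

lemma column_matroid_cong:
  assumes "finite E" and "\<And>r e. r \<in> R \<Longrightarrow> e \<in> E \<Longrightarrow> A r e = B r e"
  shows "column_matroid R E A = column_matroid R E B"
proof -
  have "(\<Sum>x\<in>X. a x * A r x) = (\<Sum>x\<in>X. a x * B r x)" if "X \<subseteq> E" "r \<in> R" for X r a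
    using assms(2) that by (intro sum.cong) auto
  then have "indeps (column_matroid R E A) = indeps (column_matroid R E B)"
    by (auto simp: set_eq_iff indeps_column_matroid_iff[OF assms(1)])
  then show ?thesis
    by (simp add: column_matroid_def)
qed

lemma basis_of_singleton:
  assumes "{e} \<in> indeps M"
  shows "basis_of M {e} B \<longleftrightarrow> B = {e}"
  using assms by (auto simp: basis_of_def subset_singleton_iff)

lemma contract_unit_column:
  assumes "finite E" and "e \<in> E" and "p \<in> R" and unit: "\<And>r. r \<in> R \<Longrightarrow> A r e = of_bool (r = p)"
  shows "contract (column_matroid R E A) {e} = column_matroid (R - {p}) (E - {e}) A"
proof -
  let ?M = "column_matroid R E A"
  \<comment> \<open>The entry 1 in row \<open>p\<close> makes the column of \<open>e\<close>
    nonzero. Hence \<open>e\<close> is not a loop, and the basis in the definition of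
    \<open>contract\<close> must be \<open>{e}\<close>.\<close>
  have "{e} \<in> indeps ?M"
    using assms by (auto simp: indeps_column_matroid_iff)
  then have basis: "basis_of ?M {e} B \<longleftrightarrow> B = {e}" for B
    by (rule basis_of_singleton)
  have insert_indep: "insert e X \<in> indeps ?M \<longleftrightarrow> X \<in> indeps (column_matroid (R - {p}) (E - {e}) A)"
    if X: "X \<subseteq> E - {e}" for X
  proof -
    have fin: "finite X" and e: "e \<notin> X"
      using X \<open>finite E\<close> by (auto intro: finite_subset)
    \<comment> \<open>Column \<open>e\<close> vanishes in every row of \<open>R\<close> but
      \<open>p\<close>, so \<open>a e\<close> enters row \<open>p\<close> only, with coefficient
      1.\<close>
    have split: "(\<forall>r\<in>R. (\<Sum>x\<in>insert e X. a x * A r x) = 0) \<longleftrightarrow>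
        a e = - (\<Sum>x\<in>X. a x * A p x) \<and> (\<forall>r\<in>R - {p}. (\<Sum>x\<in>X. a x * A r x) = 0)" for a
      using fin e unit \<open>p \<in> R\<close> by (auto simp: eq_neg_iff_add_eq_0)
    have "(\<forall>a. (\<forall>r\<in>R. (\<Sum>x\<in>insert e X. a x * A r x) = 0) \<longrightarrow> (\<forall>x\<in>insert e X. a x = 0)) \<longleftrightarrow>
        (\<forall>a. (\<forall>r\<in>R - {p}. (\<Sum>x\<in>X. a x * A r x) = 0) \<longrightarrow> (\<forall>x\<in>X. a x = 0))" (is "?L \<longleftrightarrow> ?R")
    proof
      assume L: ?L
      show ?R
      proof (intro allI impI)
        fix a
        assume a: "\<forall>r\<in>R - {p}. (\<Sum>x\<in>X. a x * A r x) = 0"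
        \<comment> \<open>Row \<open>p\<close> forces this value at \<open>e\<close>. The change
          does not affect the sums over \<open>X\<close>, because \<open>e\<close> is not in
          \<open>X\<close>.\<close>
        define b where "b = a(e := - (\<Sum>x\<in>X. a x * A p x))"
        have "(\<Sum>x\<in>X. b x * A r x) = (\<Sum>x\<in>X. a x * A r x)" for r
          using e by (intro sum.cong) (auto simp: b_def)
        with a have "\<forall>r\<in>R. (\<Sum>x\<in>insert e X. b x * A r x) = 0"
          unfolding split by (simp add: b_def)
        with L have "\<forall>x\<in>insert e X. b x = 0" by blast
        with e show "\<forall>x\<in>X. a x = 0" by (auto simp: b_def split: if_splits)
      qed
    next
      assume R: ?R
      show ?L
      proof (intro allI impI)
        fix a
        assume "\<forall>r\<in>R. (\<Sum>x\<in>insert e X. a x * A r x) = 0"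
        then have "a e = - (\<Sum>x\<in>X. a x * A p x)" and "\<forall>x\<in>X. a x = 0"
          using R unfolding split by blast+
        then show "\<forall>x\<in>insert e X. a x = 0" by simp
      qed
    qed
    with X \<open>finite E\<close> \<open>e \<in> E\<close> show ?thesis
      by (auto simp: indeps_column_matroid_iff)
  qed
  have indep_subset: "X \<subseteq> E - {e}" if "X \<in> indeps (column_matroid (R - {p}) (E - {e}) A)" for X
    using that by (simp add: column_matroid_def)
  have contract: "indeps (contract ?M {e}) = {X. X \<subseteq> E - {e} \<and> insert e X \<in> indeps ?M}"
    by (simp add: contract_def basis) (simp add: column_matroid_def)
  have "indeps (contract ?M {e}) = indeps (column_matroid (R - {p}) (E - {e}) A)"
  proof (rule set_eqI)
    fix X
    show "X \<in> indeps (contract ?M {e}) \<longleftrightarrow> X \<in> indeps (column_matroid (R - {p}) (E - {e}) A)"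
      unfolding contract mem_Collect_eq using insert_indep[of X] indep_subset[of X] by argo
  qed
  moreover have "ground (contract ?M {e}) = ground (column_matroid (R - {p}) (E - {e}) A)"
    by (simp add: contract_def column_matroid_def)
  ultimately show ?thesis
    by (intro matroid.equality) auto
qed

theorem theorem36:
  fixes G :: "'a looped_graph" and v :: 'a
  assumes "looped_simple_graph G" and "v \<in> verts G"
  shows "ias_matroid (delete_vertex G v) =
    delete (delete (contract (ias_matroid G) {Phi v}) {Chi v}) {Psi v}"
proof -
  let ?H = "delete_vertex G v"
  interpret looped_simple_graph G by fact
  have fin: "finite (ias_ground G)" "finite (ias_ground ?H)"
    using finite_verts by (auto simp: ias_ground_def delete_vertex_def)
  have ground: "ias_ground ?H = ias_ground G - {Phi v} - {Chi v} - {Psi v}"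
    by (auto simp: ias_ground_def delete_vertex_def)
  \<comment> \<open>The unit column is that of \<open>Phi v\<close> in the identity block, with
    \<open>p = v\<close>.\<close>
  have "contract (ias_matroid G) {Phi v} =
      column_matroid (verts G - {v}) (ias_ground G - {Phi v}) (ias_matrix G)"
    unfolding ias_matroid_def using fin assms(2)
    by (intro contract_unit_column) (auto simp: ias_ground_def identity_matrix_def)
  then have "delete (delete (contract (ias_matroid G) {Phi v}) {Chi v}) {Psi v} =
      column_matroid (verts ?H) (ias_ground ?H) (ias_matrix G)"
    by (simp add: delete_column_matroid ground) (simp add: delete_vertex_def)
  also have "\<dots> = column_matroid (verts ?H) (ias_ground ?H) (ias_matrix ?H)"
  proof (rule column_matroid_cong[OF fin(2)])
    \<comment> \<open>A pair avoiding \<open>v\<close>, possibly with \<open>r = w\<close>, is an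
      edge after the deletion exactly if it was one before.\<close>
    have "adjacency_matrix G r w = adjacency_matrix ?H r w" if "r \<noteq> v" "w \<noteq> v" for r w
      using that by (simp add: adjacency_matrix_def delete_vertex_def eq_commute[of v])
    then show "ias_matrix G r x = ias_matrix ?H r x" if "r \<in> verts ?H" "x \<in> ias_ground ?H" for r x
      using that by (auto simp: ias_ground_def) (auto simp: delete_vertex_def)
  qed
  finally show ?thesis
    by (simp add: ias_matroid_def)
qed

end
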